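(* Let $G$ be a finite, simple, connected graph on $\nu$ vertices with a perfect matching $M$. Suppose that for any vertices $x,y\in V(G)$ that are the two endvertices of some closed $M$-alternating path, $d(x)+d(y)\geq\nu-1$. Then $G$ has a closed $M$-alternating Hamilton path.
   Context: $d(x)$ is the degree of $x$. A perfect matching $M$ is a set of pairwise non-adjacent edges covering every vertex. An $M$-alternating path is a path whose edges lie alternately in $M$ and in $E(G)\setminus M$. A closed $M$-alternating path is either a single edge of $M$ or an $M$-alternating path whose first and last edges belong to $M$. A closed $M$-alternating Hamilton path is a closed $M$-alternating path containing all vertices of $G$. *)

theory Defs
  imports "Graph_Theory.Graph_Theory"
begin

text \<open>A finite simple undirected graph is a \<^locale>\<open>pair_graph\<close> of the AFP entry Graph_Theory:
  a finite loopfree digraph whose set of arcs, being ordered pairs, has no parallel arcs and is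
  symmetric. An undirected edge \<open>{u, v}\<close> is thus a pair of opposite arcs, and the degree of a
  vertex is its \<^const>\<open>out_degree\<close>. Matchings consist of undirected edges, i.e. of two-element
  vertex sets.\<close>

definition undirected_edges :: "'a pair_pre_digraph \<Rightarrow> 'a set set" where
  "undirected_edges G = {{u, v} | u v. (u, v) \<in> parcs G}"

definition perfect_matching :: "'a pair_pre_digraph \<Rightarrow> 'a set set \<Rightarrow> bool" where
  "perfect_matching G M \<longleftrightarrow>
     M \<subseteq> undirected_edges G \<and> pairwise disjnt M \<and> \<Union>M = pverts G"

definition path_edges :: "'a vwalk \<Rightarrow> 'a set list" where
  "path_edges p = map (\<lambda>(u, v). {u, v}) (vwalk_arcs p)"

definition alternating_path :: "'a pair_pre_digraph \<Rightarrow> 'a set set \<Rightarrow> 'a vwalk \<Rightarrow> bool" where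
  "alternating_path G M p \<longleftrightarrow> vpath p G \<and>
     (\<forall>i. Suc i < length (path_edges p) \<longrightarrow>
        (path_edges p ! i \<in> M \<longleftrightarrow> path_edges p ! Suc i \<notin> M))"

text \<open>The case of a single edge of \<open>M\<close> needs no separate clause: it is a path whose first and
  last edge coincide and lie in \<open>M\<close>. The trivial path with no edge is not closed alternating.\<close>

definition closed_alternating_path ::
    "'a pair_pre_digraph \<Rightarrow> 'a set set \<Rightarrow> 'a vwalk \<Rightarrow> bool" where
  "closed_alternating_path G M p \<longleftrightarrow> alternating_path G M p \<and>
     path_edges p \<noteq> [] \<and> hd (path_edges p) \<in> M \<and> last (path_edges p) \<in> M"

definition closed_alternating_Hamilton_path ::
    "'a pair_pre_digraph \<Rightarrow> 'a set set \<Rightarrow> 'a vwalk \<Rightarrow> bool" where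
  "closed_alternating_Hamilton_path G M p \<longleftrightarrow>
     closed_alternating_path G M p \<and> set p = pverts G"

end

theory Submission
  imports Defs
begin

text \<open>Let \<open>P\<close> be a longest closed \<open>M\<close>-alternating path, with \<open>k\<close> edges of \<open>M\<close>, and suppose that it
  misses a vertex. Among the closed \<open>M\<close>-alternating paths that avoid \<open>P\<close> let \<open>Q\<close> be a longest one,
  with \<open>t\<close> edges of \<open>M\<close> and ends \<open>q, q'\<close>. Then \<open>q\<close> and \<open>q'\<close> have neighbours only on \<open>P\<close> and \<open>Q\<close>.
  Write \<open>P = x\<^sub>0 y\<^sub>0 x\<^sub>1 y\<^sub>1 \<dots>\<close> with \<open>{x\<^sub>i, y\<^sub>i} \<in> M\<close>. If \<open>q\<close> is adjacent to \<open>y\<^sub>i\<close> and \<open>q'\<close> to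
  \<open>x\<^sub>i\<^sub>+\<^sub>t\<close>, then replacing the \<open>t - 1\<close> matching edges of \<open>P\<close> in between by \<open>Q\<close> gives a path longer
  than \<open>P\<close>. Hence \<open>{i + t | i. q \<sim> y\<^sub>i}\<close> and \<open>{i. q' \<sim> x\<^sub>i}\<close> are disjoint, and since appending a
  part of \<open>P\<close> to \<open>Q\<close> gives no longer path either, both lie in \<open>{t..<k}\<close>. The same holds with \<open>q\<close> and
  \<open>q'\<close> exchanged, so \<open>d(q) + d(q') \<le> 2 (2 t - 1) + 2 (k - t) = 2 k + 2 t - 2 \<le> \<nu> - 2\<close>, contrary to
  the degree condition.\<close>

section \<open>Neighbourhoods and matching partners\<close>

locale perfectly_matched_graph = pair_graph G for G :: "'a pair_pre_digraph" +
  fixes M :: "'a set set"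
  assumes perfect: "perfect_matching G M"
begin

abbreviation nbrs :: "'a \<Rightarrow> 'a set" where
  "nbrs x \<equiv> {y. (x, y) \<in> parcs G}"

lemma arc_sym: "(u, v) \<in> parcs G \<Longrightarrow> (v, u) \<in> parcs G"
  using pair_sym_arcs by (auto simp: symmetric_def dest: symD)

lemma matching_arc: "{u, v} \<in> M \<Longrightarrow> (u, v) \<in> parcs G"
proof -
  assume "{u, v} \<in> M"
  then obtain a b where "{u, v} = {a, b}" "(a, b) \<in> parcs G"
    using perfect unfolding perfect_matching_def undirected_edges_def by blast
  then show ?thesis using arc_sym by (auto simp: doubleton_eq_iff)
qed

lemma matching_unique: "e \<in> M \<Longrightarrow> f \<in> M \<Longrightarrow> v \<in> e \<Longrightarrow> v \<in> f \<Longrightarrow> e = f"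
  using perfect unfolding perfect_matching_def pairwise_def disjnt_def by blast

lemma partner:
  assumes "v \<in> pverts G"
  obtains w where "{v, w} \<in> M"
proof -
  obtain e where e: "e \<in> M" "v \<in> e" using assms perfect unfolding perfect_matching_def by blast
  then obtain a b where "e = {a, b}"
    using perfect unfolding perfect_matching_def undirected_edges_def by blast
  then show thesis using e that by (auto simp: insert_commute)
qed

lemma out_degree_nbrs: "out_degree (with_proj G) x = card (nbrs x)"
proof -
  have "out_arcs (with_proj G) x = Pair x ` nbrs x" by (auto simp: out_arcs_def)
  then show ?thesis unfolding out_degree_def by (simp add: card_image inj_on_def)
qed

section \<open>Cutting, joining and reversing closed alternating paths\<close>

text \<open>Alternation is encoded by the parity of positions, so that cutting and joining only
  require parity checks. That edges at odd positions lie outside \<open>M\<close> follows from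
  distinctness, because the edges of \<open>M\<close> are disjoint.\<close>

definition matched_path :: "'a list \<Rightarrow> bool" where
  "matched_path p \<longleftrightarrow> p \<noteq> [] \<and> even (length p) \<and> distinct p \<and>
     (\<forall>i. Suc i < length p \<longrightarrow>
        (p ! i, p ! Suc i) \<in> parcs G \<and> (even i \<longrightarrow> {p ! i, p ! Suc i} \<in> M))"

lemma matched_path_edge: "{u, v} \<in> M \<Longrightarrow> matched_path [u, v]"
  using matching_arc[of u v] pair_no_loops[of "(u, v)"] by (auto simp: matched_path_def)

text \<open>Since \<open>p\<close> has even length, the joining edge sits at an odd position, where
  any arc will do, and positions in \<open>q\<close> keep their parity.\<close>

lemma matched_path_append:
  assumes p: "matched_path p" and q: "matched_path q" and "set p \<inter> set q = {}"
    and arc: "(last p, hd q) \<in> parcs G"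
  shows "matched_path (p @ q)"
proof -
  have ne: "p \<noteq> []" "q \<noteq> []" "even (length p)" "even (length q)"
    using p q by (auto simp: matched_path_def)
  have "((p @ q) ! i, (p @ q) ! Suc i) \<in> parcs G \<and> (even i \<longrightarrow> {(p @ q) ! i, (p @ q) ! Suc i} \<in> M)"
    if i: "Suc i < length (p @ q)" for i
  proof -
    consider "Suc i < length p" | "Suc i = length p" | "i \<ge> length p" by linarith
    then show ?thesis
    proof cases
      case 1
      then show ?thesis using p by (simp add: matched_path_def nth_append)
    next
      case 2
      then have "odd i" using ne by (metis even_Suc)
      moreover have "i = length p - 1" using 2 by simp
      ultimately show ?thesis
        using 2 arc ne by (simp add: nth_append last_conv_nth hd_conv_nth)
    next
      case 3
      then obtain j where j: "i = length p + j" using le_Suc_ex by blast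
      then have "Suc j < length q" using i by simp
      then show ?thesis using q ne j by (simp add: matched_path_def nth_append)
    qed
  qed
  then show ?thesis using assms by (auto simp: matched_path_def)
qed

lemma matched_path_take:
  assumes "matched_path p" "2 * Suc i \<le> length p"
  shows "matched_path (take (2 * Suc i) p)"
  using assms by (auto simp: matched_path_def min_def)

lemma matched_path_drop:
  assumes "matched_path p" "2 * i < length p"
  shows "matched_path (drop (2 * i) p)"
  using assms by (auto simp: matched_path_def)

text \<open>Mirroring an edge index keeps its parity, as the length is even.\<close>

lemma matched_path_rev:
  assumes p: "matched_path p"
  shows "matched_path (rev p)"
proof -
  have "(rev p ! i, rev p ! Suc i) \<in> parcs G \<and> (even i \<longrightarrow> {rev p ! i, rev p ! Suc i} \<in> M)"
    if i: "Suc i < length p" for i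
  proof -
    define j where "j = length p - Suc (Suc i)"
    have j: "length p = j + i + 2" "rev p ! i = p ! Suc j" "rev p ! Suc i = p ! j"
      using i by (auto simp: j_def rev_nth Suc_diff_Suc)
    have "even i \<longleftrightarrow> even j" using p j(1) by (auto simp: matched_path_def)
    then show ?thesis using p j arc_sym by (auto simp: matched_path_def insert_commute)
  qed
  then show ?thesis using p by (auto simp: matched_path_def)
qed

text \<open>The edges of \<open>M\<close> on the path cover its vertices, and each vertex lies in
  only one edge of \<open>M\<close>. Hence the vertices off a path are matched among
  themselves.\<close>

lemma matched_path_closed:
  assumes p: "matched_path p" and "u \<in> set p" and uv: "{u, v} \<in> M"
  shows "v \<in> set p"
proof -
  obtain i where i: "i < length p" "u = p ! i" using assms by (auto simp: in_set_conv_nth)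
  have "\<exists>j. Suc j < length p \<and> even j \<and> (i = j \<or> i = Suc j)"
  proof (cases "even i")
    case True
    then have "Suc i \<noteq> length p" using p by (metis even_Suc matched_path_def)
    then show ?thesis using i True by (intro exI[of _ i]) auto
  next
    case False
    then show ?thesis using i by (intro exI[of _ "i - 1"]) (auto elim: oddE)
  qed
  then obtain j where j: "Suc j < length p" "even j" "i = j \<or> i = Suc j" by blast
  then have "{p ! j, p ! Suc j} \<in> M" using p by (auto simp: matched_path_def)
  then have "{u, v} = {p ! j, p ! Suc j}" using uv i j by (intro matching_unique[of _ _ u]) auto
  then have "v = p ! j \<or> v = p ! Suc j" by (auto simp: doubleton_eq_iff)
  then show ?thesis using j by auto
qed

lemma matched_path_verts: "matched_path p \<Longrightarrow> set p \<subseteq> pverts G"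
proof
  fix v assume p: "matched_path p" and "v \<in> set p"
  then obtain i where i: "i < length p" "v = p ! i" by (auto simp: in_set_conv_nth)
  show "v \<in> pverts G"
  proof (cases "Suc i < length p")
    case True
    then show ?thesis using p i in_arcsD1 by (auto simp: matched_path_def)
  next
    case False
    moreover have "length p \<noteq> 1" using p by (auto simp: matched_path_def)
    ultimately obtain j where "i = Suc j" using i by (cases i) auto
    then show ?thesis using p i in_arcsD2 by (auto simp: matched_path_def)
  qed
qed

lemma matched_path_length: "matched_path p \<Longrightarrow> length p = card (set p)"
  by (simp add: matched_path_def distinct_card)

lemma matched_path_closed_alternating:
  assumes p: "matched_path p"
  shows "closed_alternating_path G M p"
proof -
  have arcs: "length (vwalk_arcs q) = length q - 1 \<and>
      (\<forall>i. Suc i < length q \<longrightarrow> vwalk_arcs q ! i = (q ! i, q ! Suc i))" for q :: "'a list"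
    by (induction q rule: vwalk_arcs.induct) (auto simp: nth_Cons split: nat.splits)
  have len: "length (path_edges p) = length p - 1"
    using arcs by (simp add: path_edges_def)
  have nth: "path_edges p ! i = {p ! i, p ! Suc i}" if "Suc i < length p" for i
    using arcs that by (simp add: path_edges_def)
  have in_M: "path_edges p ! i \<in> M \<longleftrightarrow> even i" if i: "Suc i < length p" for i
  proof (cases "even i")
    case True
    then show ?thesis using p i nth by (simp add: matched_path_def)
  next
    case False
    then obtain j where j: "i = Suc j" "even j" by (cases i) auto
    \<comment> \<open>The preceding edge is the edge of \<open>M\<close> at \<open>p ! i\<close>,
      and by distinctness the next edge differs from it.\<close>
    have "{p ! j, p ! i} \<in> M" using p i j by (auto simp: matched_path_def)
    moreover have "p ! Suc i \<notin> {p ! j, p ! i}"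
      using p i j by (auto simp: matched_path_def nth_eq_iff_index_eq)
    ultimately have "{p ! i, p ! Suc i} \<notin> M"
      using matching_unique[of "{p ! j, p ! i}" "{p ! i, p ! Suc i}" "p ! i"] by auto
    then show ?thesis using False nth[OF i] by simp
  qed
  have "even (length p)" "p \<noteq> []" using p by (auto simp: matched_path_def)
  then have two: "length p \<ge> 2" "even (length p)" "p \<noteq> []" by (auto intro: dvd_imp_le)
  have "set (vwalk_arcs p) \<subseteq> parcs G"
    using p arcs[of p] by (fastforce simp: in_set_conv_nth matched_path_def)
  then have "vpath p G"
    using p matched_path_verts[OF p] by (simp add: matched_path_def vpath_def vwalk_def)
  moreover have ne: "path_edges p \<noteq> []" using len two by (auto simp flip: length_0_conv)
  moreover have "hd (path_edges p) \<in> M"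
    using ne in_M[of 0] two by (simp add: hd_conv_nth)
  \<comment> \<open>The last edge has index \<open>length p - 2\<close>, which is even.\<close>
  moreover have "last (path_edges p) \<in> M"
    using ne in_M[of "length p - 2"] two len by (simp add: last_conv_nth numeral_2_eq_2)
  ultimately show ?thesis
    using in_M len unfolding closed_alternating_path_def alternating_path_def by auto
qed

text \<open>Distinctness bounds the length by the number of vertices. The predicate \<open>R\<close>
  is trivial in the choice of \<open>P\<close> and demands avoiding \<open>P\<close> in that of
  \<open>Q\<close>.\<close>

lemma ex_longest_matched_path:
  assumes "matched_path p" "R p"
  obtains q where "matched_path q" "R q"
    "\<And>r. matched_path r \<Longrightarrow> R r \<Longrightarrow> length r \<le> length q"
proof -
  have "\<forall>r. matched_path r \<and> R r \<longrightarrow> length r < Suc (card (pverts G))"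
    using matched_path_length matched_path_verts by (simp add: card_mono less_Suc_eq_le)
  from ex_has_greatest_nat[of "\<lambda>r. matched_path r \<and> R r" p length, OF _ this]
  show thesis using assms that by blast
qed

section \<open>Counting the neighbours of the ends of \<open>Q\<close>\<close>

text \<open>Here \<open>P ! (2 * i)\<close> is \<open>x\<^sub>i\<close> and
  \<open>P ! Suc (2 * i)\<close> is \<open>y\<^sub>i\<close>. Shifted by \<open>t\<close>,
  \<open>?Y\<close> is disjoint from \<open>?X\<close>, and both lie in
  \<open>{t..<k}\<close>.\<close>

lemma card_cross_nbrs_le:
  assumes P: "matched_path P" and longest: "\<And>r. matched_path r \<Longrightarrow> length r \<le> length P"
    and Q: "matched_path Q" and disj: "set P \<inter> set Q = {}"
    and k: "length P = 2 * k" and t: "length Q = 2 * t"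
  shows "card {i. i < k \<and> P ! Suc (2 * i) \<in> nbrs (hd Q)} +
         card {i. i < k \<and> P ! (2 * i) \<in> nbrs (last Q)} \<le> k - t"
    (is "card ?Y + card ?X \<le> _")
proof -
  have t0: "t > 0" using Q t by (cases t) (auto simp: matched_path_def)
  have prefix: "matched_path (take (2 * Suc i) P @ Q)" if i: "i \<in> ?Y" for i
  proof (intro matched_path_append matched_path_take P Q)
    have "last (take (2 * Suc i) P) = P ! Suc (2 * i)"
      using i k by (subst last_conv_nth) auto
    then show "(last (take (2 * Suc i) P), hd Q) \<in> parcs G" using i arc_sym by simp
    show "set (take (2 * Suc i) P) \<inter> set Q = {}" using disj set_take_subset by fastforce
  qed (use i k in auto)
  \<comment> \<open>\<open>p\<close> is general because it stands both for \<open>Q\<close> alone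
    and for a prefix of \<open>P\<close> followed by \<open>Q\<close>.\<close>
  have suffix: "matched_path (p @ drop (2 * i) P)"
    if i: "i \<in> ?X" and p: "matched_path p" "last p = last Q" "set p \<inter> set (drop (2 * i) P) = {}"
    for i p
  proof (intro matched_path_append matched_path_drop P p)
    show "(last p, hd (drop (2 * i) P)) \<in> parcs G"
      using i k p by (simp add: hd_drop_conv_nth)
  qed (use i k in auto)
  have Y: "i + t < k" if "i \<in> ?Y" for i
    using longest[OF prefix[OF that]] that k t by simp
  have X: "t \<le> i" if "i \<in> ?X" for i
  proof -
    have "set Q \<inter> set (drop (2 * i) P) = {}" using disj set_drop_subset by fastforce
    from longest[OF suffix[OF that Q _ this]] show ?thesis using that k t by simp
  qed
  have "i + t \<notin> ?X" if i: "i \<in> ?Y" for i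
  proof
    assume it: "i + t \<in> ?X"
    \<comment> \<open>As \<open>t > 0\<close>, the two pieces of \<open>P\<close> do not overlap;
      with \<open>Q\<close> between them there are \<open>2 * k + 2\<close> vertices.\<close>
    have "set (take (2 * Suc i) P) \<inter> set (drop (2 * (i + t)) P) = {}"
      using P t0 by (intro set_take_disj_set_drop_if_distinct) (auto simp: matched_path_def)
    moreover have "set Q \<inter> set (drop (2 * (i + t)) P) = {}"
      using disj set_drop_subset by fastforce
    moreover have "Q \<noteq> []" using Q by (simp add: matched_path_def)
    ultimately have "matched_path ((take (2 * Suc i) P @ Q) @ drop (2 * (i + t)) P)"
      by (intro suffix[OF it prefix[OF i]]) auto
    from longest[OF this] show False using it k t t0 by simp
  qed
  then have "card ((\<lambda>i. i + t) ` ?Y) + card ?X = card ((\<lambda>i. i + t) ` ?Y \<union> ?X)"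
    by (subst card_Un_disjoint) auto
  also have "\<dots> \<le> card {t..<k}" using X Y by (intro card_mono) auto
  finally show ?thesis by (simp add: card_image)
qed

text \<open>A neighbour \<open>w\<close> of \<open>hd Q\<close> off both paths would have its
  partner \<open>v\<close> off them too, and \<open>v, w\<close> could be put in front of
  \<open>Q\<close>. The \<open>- 1\<close> accounts for \<open>hd Q\<close>, which is not its own
  neighbour.\<close>

lemma card_nbrs_hd_le:
  assumes P: "matched_path P" and Q: "matched_path Q" and disj: "set P \<inter> set Q = {}"
    and longest: "\<And>r. matched_path r \<Longrightarrow> set P \<inter> set r = {} \<Longrightarrow> length r \<le> length Q"
    and k: "length P = 2 * k"
  shows "card (nbrs (hd Q)) \<le> length Q - 1 +
    (card {i. i < k \<and> P ! (2 * i) \<in> nbrs (hd Q)} + card {i. i < k \<and> P ! Suc (2 * i) \<in> nbrs (hd Q)})"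
    (is "_ \<le> _ + (card ?X + card ?Y)")
proof -
  have hd: "hd Q \<in> set Q" using Q by (simp add: matched_path_def)
  have "w \<in> set P \<union> (set Q - {hd Q})" if w: "w \<in> nbrs (hd Q)" for w
  proof (rule ccontr)
    assume out: "w \<notin> set P \<union> (set Q - {hd Q})"
    have "w \<noteq> hd Q" using w pair_no_loops by fastforce
    then have wQ: "w \<notin> set Q" using out by simp
    obtain v where wv: "{w, v} \<in> M" using partner w in_arcsD2 by blast
    then have vw: "{v, w} \<in> M" by (simp add: insert_commute)
    have "v \<notin> set P" "v \<notin> set Q" using matched_path_closed[OF _ _ vw] P Q out wQ by auto
    moreover have "matched_path ([v, w] @ Q)"
      using w wQ calculation arc_sym vw
      by (intro matched_path_append matched_path_edge Q) auto
    ultimately show False using longest[of "[v, w] @ Q"] out disj by auto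
  qed
  moreover have "set P \<inter> nbrs (hd Q) \<subseteq> (\<lambda>i. P ! (2 * i)) ` ?X \<union> (\<lambda>i. P ! Suc (2 * i)) ` ?Y"
  proof
    fix w assume w: "w \<in> set P \<inter> nbrs (hd Q)"
    then obtain i where i: "i < 2 * k" "w = P ! i" using k by (auto simp: in_set_conv_nth)
    show "w \<in> (\<lambda>i. P ! (2 * i)) ` ?X \<union> (\<lambda>i. P ! Suc (2 * i)) ` ?Y"
    proof (cases "even i")
      case True
      then obtain j where "i = 2 * j" by (rule evenE)
      then show ?thesis using i w by auto
    next
      case False
      then obtain j where "i = Suc (2 * j)" by (auto elim: oddE)
      then show ?thesis using i w by auto
    qed
  qed
  ultimately have
    "nbrs (hd Q) \<subseteq> (set Q - {hd Q}) \<union> ((\<lambda>i. P ! (2 * i)) ` ?X \<union> (\<lambda>i. P ! Suc (2 * i)) ` ?Y)"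
    by blast
  then have "card (nbrs (hd Q)) \<le>
      card ((set Q - {hd Q}) \<union> ((\<lambda>i. P ! (2 * i)) ` ?X \<union> (\<lambda>i. P ! Suc (2 * i)) ` ?Y))"
    by (intro card_mono) auto
  also have "\<dots> \<le> card (set Q - {hd Q}) +
      (card ((\<lambda>i. P ! (2 * i)) ` ?X) + card ((\<lambda>i. P ! Suc (2 * i)) ` ?Y))"
    by (rule order_trans[OF card_Un_le add_left_mono[OF card_Un_le]])
  also have "\<dots> \<le> card (set Q - {hd Q}) + (card ?X + card ?Y)"
    by (intro add_mono card_image_le order_refl) auto
  also have "card (set Q - {hd Q}) = length Q - 1"
    using hd matched_path_length[OF Q] by simp
  finally show ?thesis .
qed

lemma low_degree_ends:
  assumes P: "matched_path P" and longest_P: "\<And>r. matched_path r \<Longrightarrow> length r \<le> length P"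
    and Q: "matched_path Q" and disj: "set P \<inter> set Q = {}"
    and longest_Q: "\<And>r. matched_path r \<Longrightarrow> set P \<inter> set r = {} \<Longrightarrow> length r \<le> length Q"
  shows "card (nbrs (hd Q)) + card (nbrs (last Q)) < card (pverts G) - 1"
proof -
  obtain k t where k: "length P = 2 * k" and t: "length Q = 2 * t"
    using P Q by (auto simp: matched_path_def elim!: evenE)
  have t0: "t > 0" using Q t by (cases t) (auto simp: matched_path_def)
  have tk: "t \<le> k" using longest_P[OF Q] k t by simp
  \<comment> \<open>Reversal exchanges the ends of \<open>Q\<close>, so both counting lemmas also
    apply with \<open>last Q\<close> as head.\<close>
  have Q': "matched_path (rev Q)" using Q by (rule matched_path_rev)
  have ends: "hd (rev Q) = last Q" "last (rev Q) = hd Q"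
    using Q by (auto simp: matched_path_def hd_rev last_rev)
  have "2 * k + 2 * t = card (set P \<union> set Q)"
    using disj k t P Q by (simp add: card_Un_disjoint matched_path_length[symmetric])
  also have "\<dots> \<le> card (pverts G)"
    using matched_path_verts P Q by (intro card_mono pair_finite_verts) auto
  finally have "2 * k + 2 * t \<le> card (pverts G)" .
  moreover note card_cross_nbrs_le[OF P longest_P Q disj k t]
  moreover have "card {i. i < k \<and> P ! Suc (2 * i) \<in> nbrs (last Q)} +
      card {i. i < k \<and> P ! (2 * i) \<in> nbrs (hd Q)} \<le> k - t"
    using card_cross_nbrs_le[OF P longest_P Q' _ k, of t] disj t ends by simp
  moreover note card_nbrs_hd_le[OF P Q disj longest_Q k]
  moreover have "card (nbrs (last Q)) \<le> length Q - 1 +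
      (card {i. i < k \<and> P ! (2 * i) \<in> nbrs (last Q)} +
       card {i. i < k \<and> P ! Suc (2 * i) \<in> nbrs (last Q)})"
    using card_nbrs_hd_le[OF P Q' _ _ k] disj longest_Q ends by simp
  \<comment> \<open>The degree sum is at most \<open>2 * (2 * t - 1) + 2 * (k - t)\<close>;
    \<open>t0\<close> and \<open>tk\<close> make these natural subtractions exact.\<close>
  ultimately show ?thesis using t t0 tk by linarith
qed

end

section \<open>The choice of \<open>P\<close> and \<open>Q\<close>\<close>

theorem theorem3p1:
  fixes G :: "'a pair_pre_digraph" and M :: "'a set set"
  assumes "pair_graph G"
    and "Digraph_Component.connected (with_proj G)"
    and "perfect_matching G M"
    and "\<And>x y p. closed_alternating_path G M p \<Longrightarrow> hd p = x \<Longrightarrow> last p = y \<Longrightarrow>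
           out_degree (with_proj G) x + out_degree (with_proj G) y \<ge> card (pverts G) - 1"
  shows "\<exists>p. closed_alternating_Hamilton_path G M p"
proof -
  interpret pair_graph G by fact
  interpret perfectly_matched_graph G M by unfold_locales fact
  \<comment> \<open>Connectedness includes having a vertex, so \<open>M\<close> has an edge from
    which to start the choice of \<open>P\<close>.\<close>
  have "pverts G \<noteq> {}"
    using assms(2) by (auto simp: connected_def strongly_connected_def)
  then obtain u v where "{u, v} \<in> M" using partner by blast
  then obtain P where P: "matched_path P"
    and longest_P: "\<And>r. matched_path r \<Longrightarrow> length r \<le> length P"
    by (rule ex_longest_matched_path[OF matched_path_edge, of u v "\<lambda>_. True"]) auto
  have "set P = pverts G"
  proof (rule ccontr)
    assume "set P \<noteq> pverts G"
    then obtain a where a: "a \<in> pverts G" "a \<notin> set P" using matched_path_verts[OF P] by blast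
    obtain b where ab: "{a, b} \<in> M" using partner a by blast
    \<comment> \<open>The partner of \<open>a\<close> avoids \<open>P\<close> as well, so
      \<open>[a, b]\<close> is a candidate for \<open>Q\<close>.\<close>
    then have "b \<notin> set P" using matched_path_closed[OF P, of b a] a by (auto simp: insert_commute)
    then obtain Q where Q: "matched_path Q" "set P \<inter> set Q = {}"
      and longest_Q: "\<And>r. matched_path r \<Longrightarrow> set P \<inter> set r = {} \<Longrightarrow> length r \<le> length Q"
      using ex_longest_matched_path[OF matched_path_edge[OF ab], of "\<lambda>r. set P \<inter> set r = {}"] a
      by auto
    have "card (nbrs (hd Q)) + card (nbrs (last Q)) < card (pverts G) - 1"
      by (rule low_degree_ends[OF P longest_P Q longest_Q])
    moreover have "card (nbrs (hd Q)) + card (nbrs (last Q)) \<ge> card (pverts G) - 1"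
      using assms(4)[OF matched_path_closed_alternating[OF Q(1)] refl refl]
      unfolding out_degree_nbrs .
    ultimately show False by linarith
  qed
  then show ?thesis
    using matched_path_closed_alternating[OF P]
    unfolding closed_alternating_Hamilton_path_def by blast
qed

end
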